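(* Let $G$ be a second countable locally compact group and $H$ a closed subgroup of $G$. Assume that $G/H$ is connected. The following two conditions are equivalent: (i) there exists a $G$-invariant compatible metric on $G/H$; (ii) there exists a proper $G$-invariant compatible metric on $G/H$.
   Context: All topological spaces and topological groups are Hausdorff. For a closed subgroup $H$ of a topological group $G$, the coset space $G/H=\{gH : g\in G\}$ carries the quotient topology, and $G$ acts on it by left translation. A compatible metric on a topological space is a metric inducing its topology. A metric $d$ on $G/H$ is $G$-invariant if $d(gx,gy)=d(x,y)$ for all $g\in G$ and $x,y\in G/H$. A metric is proper if all its closed balls $\{y : d(x,y)\le r\}$ are compact. *)

theory Defs
  imports "HOL-Analysis.Analysis" "HOL-Algebra.Left_Coset"
begin

locale topological_group = group G for G (structure) +
  fixes T :: "'a topology"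
  assumes topspace_eq: "topspace T = carrier G"
    and Hausdorff: "Hausdorff_space T"
    and continuous_mult: "continuous_map (prod_topology T T) T (\<lambda>(x, y). x \<otimes> y)"
    and continuous_inv: "continuous_map T T (\<lambda>x. inv x)"

definition coset_topology ::
    "('a, 'b) monoid_scheme \<Rightarrow> 'a topology \<Rightarrow> 'a set \<Rightarrow> 'a set topology" where
  "coset_topology G T H =
     topology (\<lambda>U. U \<subseteq> lcosets\<^bsub>G\<^esub> H \<and> openin T {g \<in> topspace T. g <#\<^bsub>G\<^esub> H \<in> U})"

lemma openin_coset_topology:
  "openin (coset_topology G T H) U \<longleftrightarrow>
     U \<subseteq> lcosets\<^bsub>G\<^esub> H \<and> openin T {g \<in> topspace T. g <#\<^bsub>G\<^esub> H \<in> U}"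
proof -
  have "istopology (\<lambda>U. U \<subseteq> lcosets\<^bsub>G\<^esub> H \<and> openin T {g \<in> topspace T. g <#\<^bsub>G\<^esub> H \<in> U})"
    unfolding istopology_def
  proof (intro conjI allI impI)
    fix S U
    assume "S \<subseteq> lcosets\<^bsub>G\<^esub> H \<and> openin T {g \<in> topspace T. g <#\<^bsub>G\<^esub> H \<in> S}"
      and "U \<subseteq> lcosets\<^bsub>G\<^esub> H \<and> openin T {g \<in> topspace T. g <#\<^bsub>G\<^esub> H \<in> U}"
    moreover have "{g \<in> topspace T. g <#\<^bsub>G\<^esub> H \<in> S \<inter> U} =
        {g \<in> topspace T. g <#\<^bsub>G\<^esub> H \<in> S} \<inter> {g \<in> topspace T. g <#\<^bsub>G\<^esub> H \<in> U}"
      by auto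
    ultimately show "S \<inter> U \<subseteq> lcosets\<^bsub>G\<^esub> H"
      and "openin T {g \<in> topspace T. g <#\<^bsub>G\<^esub> H \<in> S \<inter> U}"
      by auto
  next
    fix K
    assume K: "\<forall>U\<in>K. U \<subseteq> lcosets\<^bsub>G\<^esub> H \<and> openin T {g \<in> topspace T. g <#\<^bsub>G\<^esub> H \<in> U}"
    then show "\<Union>K \<subseteq> lcosets\<^bsub>G\<^esub> H" by blast
    have "{g \<in> topspace T. g <#\<^bsub>G\<^esub> H \<in> \<Union>K} = (\<Union>U\<in>K. {g \<in> topspace T. g <#\<^bsub>G\<^esub> H \<in> U})"
      by auto
    with K show "openin T {g \<in> topspace T. g <#\<^bsub>G\<^esub> H \<in> \<Union>K}"
      by auto
  qed
  then show ?thesis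
    by (simp add: coset_topology_def)
qed

lemma topspace_coset_topology:
  assumes "topspace T = carrier G"
  shows "topspace (coset_topology G T H) = lcosets\<^bsub>G\<^esub> H"
proof -
  have "{g \<in> topspace T. g <#\<^bsub>G\<^esub> H \<in> lcosets\<^bsub>G\<^esub> H} = topspace T"
    using assms by (auto simp: LCOSETS_def)
  then have "openin (coset_topology G T H) (lcosets\<^bsub>G\<^esub> H)"
    by (simp add: openin_coset_topology)
  moreover have "topspace (coset_topology G T H) \<subseteq> lcosets\<^bsub>G\<^esub> H"
    using openin_topspace openin_coset_topology by blast
  ultimately show ?thesis
    by (meson openin_subset subset_antisym)
qed

lemma quotient_map_coset_topology:
  assumes "topspace T = carrier G"
  shows "quotient_map T (coset_topology G T H) (\<lambda>g. g <#\<^bsub>G\<^esub> H)"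
proof -
  have "(\<lambda>g. g <#\<^bsub>G\<^esub> H) ` topspace T = lcosets\<^bsub>G\<^esub> H"
    using assms by (auto simp: LCOSETS_def)
  then show ?thesis
    by (simp add: quotient_map_def topspace_coset_topology[OF assms] openin_coset_topology)
qed

definition compatible_metric :: "'a topology \<Rightarrow> ('a \<Rightarrow> 'a \<Rightarrow> real) \<Rightarrow> bool" where
  "compatible_metric X d \<longleftrightarrow>
     Metric_space (topspace X) d \<and> Metric_space.mtopology (topspace X) d = X"

text \<open>For a coset \<open>x\<close>, the set \<open>g <# x\<close> is the translated coset.\<close>

definition invariant_metric ::
    "('a, 'b) monoid_scheme \<Rightarrow> 'a set \<Rightarrow> ('a set \<Rightarrow> 'a set \<Rightarrow> real) \<Rightarrow> bool" where
  "invariant_metric G H d \<longleftrightarrow>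
     (\<forall>g \<in> carrier G. \<forall>x \<in> lcosets\<^bsub>G\<^esub> H. \<forall>y \<in> lcosets\<^bsub>G\<^esub> H.
        d (g <#\<^bsub>G\<^esub> x) (g <#\<^bsub>G\<^esub> y) = d x y)"

definition proper_metric :: "'a set \<Rightarrow> ('a \<Rightarrow> 'a \<Rightarrow> real) \<Rightarrow> bool" where
  "proper_metric M d \<longleftrightarrow>
     (\<forall>x \<in> M. \<forall>r. compactin (Metric_space.mtopology M d) (Metric_space.mcball M d x r))"

end

theory Submission
  imports Defs
begin

text \<open>
  Only the passage from an invariant metric \<open>d\<close> to a proper one needs an argument.  Since \<open>G/H\<close> is
  locally compact and \<open>G\<close> acts transitively by isometries, some \<open>r > 0\<close> works at every point
  simultaneously: all closed balls of radius \<open>r\<close> are compact.  Replace \<open>d\<close> by the length metric of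
  discrete paths whose steps are shorter than \<open>e = r/4\<close>: the distance of two points is the infimum
  of the lengths of such chains from one to the other.  Connectedness makes this infimum finite.
  The new metric agrees with \<open>d\<close> below distance \<open>e\<close>, so the topology is unchanged, and isometries
  of \<open>d\<close> carry chains to chains of the same length, so invariance is inherited.

  The gain is that a point at chain distance \<open>R + e\<close> from \<open>x\<close> is reached through a point of the ball
  of radius \<open>R\<close> from which it is less than \<open>3 * e\<close> away.  If the ball of radius \<open>R\<close> is compact, it is
  covered by finitely many balls of radius \<open>e\<close>, so the ball of radius \<open>R + e\<close> lies in finitely many
  balls of radius \<open>4 * e = r\<close> and is compact as well.  Induction reaches every radius.
\<close>

section \<open>The chain metric of a connected metric space\<close>

context Metric_space
begin

inductive chain :: "real \<Rightarrow> 'a \<Rightarrow> 'a \<Rightarrow> real \<Rightarrow> bool" for e x where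
  refl: "x \<in> M \<Longrightarrow> chain e x x 0"
| step: "chain e x y l \<Longrightarrow> z \<in> M \<Longrightarrow> d y z < e \<Longrightarrow> chain e x z (l + d y z)"

text \<open>
  The value \<open>0\<close> outside the carrier only serves the axioms of \<^locale>\<open>Metric_space\<close>, which demand
  symmetry and nonnegativity of the distance function on the whole type.
\<close>

definition chain_dist :: "real \<Rightarrow> 'a \<Rightarrow> 'a \<Rightarrow> real" where
  "chain_dist e x y = (if x \<in> M \<and> y \<in> M then Inf {l. chain e x y l} else 0)"

lemma chain_in_space: "chain e x y l \<Longrightarrow> x \<in> M \<and> y \<in> M"
  by (induction rule: chain.induct) auto

lemma chain_single:
  assumes "x \<in> M" "y \<in> M" "d x y < e"
  shows "chain e x y (d x y)"
  using chain.step[OF chain.refl[OF assms(1)] assms(2,3)] by simp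

lemma dist_le_chain: "chain e x y l \<Longrightarrow> d x y \<le> l"
proof (induction rule: chain.induct)
  case (step y l z)
  then show ?case
    using chain_in_space[OF step(1)] triangle[of x y z] by fastforce
qed simp

lemma chain_trans:
  assumes "chain e y z k" "chain e x y l"
  shows "chain e x z (l + k)"
  using assms
proof (induction rule: chain.induct)
  case (step z k w)
  then show ?case
    using chain.step[of e x z "l + k" w] by (simp add: add.assoc)
qed simp

lemma chain_sym: "chain e x y l \<Longrightarrow> chain e y x l"
proof (induction rule: chain.induct)
  case (step y l z)
  have "chain e z y (d y z)"
    using chain_single[of z y e] step chain_in_space[OF step(1)] by (simp add: commute)
  then show ?case
    using chain_trans[OF step.IH, of z "d y z"] by (simp add: add.commute)
qed (rule chain.refl)

text \<open>
  The points reachable from \<open>x\<close> form a set that is open, and so is its complement, because a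
  point within \<open>e\<close> of a reachable point is reachable.
\<close>

lemma chain_exists:
  assumes conn: "connected_space mtopology" and e: "e > 0" and x: "x \<in> M" and y: "y \<in> M"
  shows "\<exists>l. chain e x y l"
proof (rule ccontr)
  assume no: "\<not> ?thesis"
  define A where "A = {z \<in> M. \<exists>l. chain e x z l}"
  have ext: "w \<in> A" if "z \<in> A" "w \<in> M" "d z w < e" for z w
    using that chain.step unfolding A_def by blast
  have "openin mtopology A"
    unfolding openin_mtopology
  proof (intro conjI allI impI)
    fix z assume z: "z \<in> A"
    then have "mball z e \<subseteq> A"
      using ext by auto
    then show "\<exists>r>0. mball z r \<subseteq> A"
      using e by blast
  qed (auto simp: A_def)
  moreover have "openin mtopology (M - A)"
    unfolding openin_mtopology
  proof (intro conjI allI impI)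
    fix z assume z: "z \<in> M - A"
    then have "mball z e \<subseteq> M - A"
      using ext by (fastforce simp: commute)
    then show "\<exists>r>0. mball z r \<subseteq> M - A"
      using e by blast
  qed auto
  moreover have "x \<in> A" "y \<in> M - A"
    using x y no chain.refl by (auto simp: A_def)
  ultimately show False
    using conn y unfolding connected_space_clopen_in closedin_def A_def by auto
qed

lemma chain_dist_le: "chain e x y l \<Longrightarrow> chain_dist e x y \<le> l"
  using chain_in_space[of e x y l] dist_le_chain
  by (auto simp: chain_dist_def intro!: cInf_lower bdd_belowI)

lemma chain_dist_commute: "chain_dist e x y = chain_dist e y x"
proof -
  have "{l. chain e x y l} = {l. chain e y x l}"
    using chain_sym by blast
  then show ?thesis
    by (simp add: chain_dist_def conj_commute)
qed

context
  fixes e :: real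
  assumes connected: "connected_space mtopology" and e_pos: "e > 0"
begin

lemma chain_dist_approx:
  assumes "x \<in> M" "y \<in> M" "chain_dist e x y < b"
  shows "\<exists>l. chain e x y l \<and> l < b"
  using chain_exists[OF connected e_pos assms(1,2)] assms cInf_lessD[of "{l. chain e x y l}" b]
  by (auto simp: chain_dist_def)

lemma dist_le_chain_dist:
  assumes "x \<in> M" "y \<in> M"
  shows "d x y \<le> chain_dist e x y"
  using chain_exists[OF connected e_pos assms] assms dist_le_chain
  by (auto simp: chain_dist_def intro!: cInf_greatest)

lemma chain_dist_eq_dist:
  assumes "x \<in> M" "y \<in> M" "d x y < e"
  shows "chain_dist e x y = d x y"
  using dist_le_chain_dist[OF assms(1,2)] chain_dist_le[OF chain_single[OF assms]] by simp

lemma Metric_space_chain_dist: "Metric_space M (chain_dist e)"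
proof
  show "0 \<le> chain_dist e x y" for x y
    using order_trans[OF nonneg dist_le_chain_dist] by (cases "x \<in> M \<and> y \<in> M") (auto simp: chain_dist_def)
  show "chain_dist e x y = chain_dist e y x" for x y
    by (rule chain_dist_commute)
  show "chain_dist e x y = 0 \<longleftrightarrow> x = y" if "x \<in> M" "y \<in> M" for x y
    using that dist_le_chain_dist[of x y] chain_dist_eq_dist[of x y] e_pos nonneg[of x y]
    by (metis mdist_zero nle_le zero)
  show "chain_dist e x z \<le> chain_dist e x y + chain_dist e y z"
    if M: "x \<in> M" "y \<in> M" "z \<in> M" for x y z
  proof (rule field_le_epsilon)
    fix t :: real assume t: "t > 0"
    obtain l where l: "chain e x y l" "l < chain_dist e x y + t/2"
      using chain_dist_approx[of x y "chain_dist e x y + t/2"] M t by auto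
    obtain k where k: "chain e y z k" "k < chain_dist e y z + t/2"
      using chain_dist_approx[of y z "chain_dist e y z + t/2"] M t by auto
    show "chain_dist e x z \<le> chain_dist e x y + chain_dist e y z + t"
      using chain_dist_le[OF chain_trans[OF k(1) l(1)]] l(2) k(2) by argo
  qed
qed

lemma mtopology_chain_dist: "Metric_space.mtopology M (chain_dist e) = mtopology"
proof -
  interpret C: Metric_space M "chain_dist e"
    by (rule Metric_space_chain_dist)
  have small: "C.mball x (min s e) = mball x (min s e)" for x s
    by (auto simp: chain_dist_eq_dist intro: order.strict_trans1[OF dist_le_chain_dist])
  have "openin C.mtopology U \<longleftrightarrow> openin mtopology U" for U
  proof -
    have "(\<exists>s>0. C.mball x s \<subseteq> U) \<longleftrightarrow> (\<exists>s>0. mball x s \<subseteq> U)" for x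
    proof
      assume "\<exists>s>0. C.mball x s \<subseteq> U"
      then obtain s where "s > 0" "C.mball x s \<subseteq> U"
        by blast
      moreover have "C.mball x (min s e) \<subseteq> C.mball x s"
        by auto
      ultimately show "\<exists>s>0. mball x s \<subseteq> U"
        using small[of x s] e_pos by (intro exI[of _ "min s e"]) auto
    next
      assume "\<exists>s>0. mball x s \<subseteq> U"
      then obtain s where "s > 0" "mball x s \<subseteq> U"
        by blast
      moreover have "mball x (min s e) \<subseteq> mball x s"
        by auto
      ultimately show "\<exists>s>0. C.mball x s \<subseteq> U"
        using small[of x s] e_pos by (intro exI[of _ "min s e"]) auto
    qed
    then show ?thesis
      by (simp add: C.openin_mtopology openin_mtopology)
  qed
  then show ?thesis
    by (simp add: topology_eq)
qed

end

text \<open>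
  The intermediate point is the last one of the chain that is reached within length \<open>R\<close>.  If it
  is not already \<open>y\<close>, one step, shorter than \<open>e\<close>, exceeds \<open>R\<close> from there, and the rest of the chain
  has length at most \<open>l - R\<close>.
\<close>

lemma chain_split:
  assumes "chain e x y l" "0 \<le> R" "0 < e"
  shows "\<exists>z k. chain e x z k \<and> k \<le> R \<and> d z y \<le> max 0 (l - R) + e"
  using assms
proof (induction rule: chain.induct)
  case refl
  then show ?case
    by (intro exI[of _ x] exI[of _ 0]) (auto intro: chain.refl)
next
  case (step y l w)
  consider "l + d y w \<le> R" | "l \<le> R" "l + d y w > R" | "l > R"
    by linarith
  then show ?case
  proof cases
    case 1
    then show ?thesis
      using chain.step[OF step.hyps] step by fastforce
  next
    case 2
    then show ?thesis
      using step by (intro exI[of _ y] exI[of _ l]) auto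
  next
    case 3
    obtain z k where zk: "chain e x z k" "k \<le> R" "d z y \<le> max 0 (l - R) + e"
      using step by blast
    have "d z w \<le> d z y + d y w"
      using triangle chain_in_space[OF zk(1)] chain_in_space[OF step.hyps(1)] step.hyps(2) by blast
    then show ?thesis
      using zk 3 nonneg[of y w] by (intro exI[of _ z] exI[of _ k]) auto
  qed
qed

text \<open>A finite net of \<open>K\<close> of mesh \<open>e\<close> absorbs the loss of \<open>e\<close> in the radius.\<close>

lemma compactin_thickening_subset:
  assumes K: "compactin mtopology K" and e: "e > 0"
    and comp: "\<And>z. z \<in> M \<Longrightarrow> compactin mtopology (mcball z (s + e))"
  shows "\<exists>C. compactin mtopology C \<and> (\<forall>z\<in>K. mcball z s \<subseteq> C)"
proof -
  have KM: "K \<subseteq> M"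
    using compactin_subset_topspace[OF K] by simp
  obtain F where F: "finite F" "F \<subseteq> K" "K \<subseteq> (\<Union>z\<in>F. mball z e)"
    using compactin_imp_mtotally_bounded[OF K] e unfolding mtotally_bounded_def by meson
  show ?thesis
  proof (intro exI conjI ballI)
    show "compactin mtopology (\<Union>z\<in>F. mcball z (s + e))"
      using F KM comp by (intro compactin_Union) auto
    fix w assume "w \<in> K"
    then obtain z where z: "z \<in> F" "w \<in> mball z e"
      using F by blast
    have "mcball w s \<subseteq> mcball z (s + e)"
    proof
      fix y assume "y \<in> mcball w s"
      then show "y \<in> mcball z (s + e)"
        using z(2) triangle[of z w y] by auto
    qed
    then show "mcball w s \<subseteq> (\<Union>z\<in>F. mcball z (s + e))"
      using z by blast
  qed
qed

lemma proper_chain_dist: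
  assumes conn: "connected_space mtopology" and e: "e > 0"
    and comp: "\<And>z. z \<in> M \<Longrightarrow> compactin mtopology (mcball z (4 * e))"
  shows "proper_metric M (chain_dist e)"
proof -
  interpret C: Metric_space M "chain_dist e"
    by (rule Metric_space_chain_dist[OF conn e])
  have top: "C.mtopology = mtopology"
    by (rule mtopology_chain_dist[OF conn e])
  have closed: "closedin mtopology (C.mcball x R)" for x R
    using C.closedin_mcball top by simp
  have multiples: "compactin mtopology (C.mcball x (real n * e))" if x: "x \<in> M" for x n
  proof (induction n)
    case 0
    have "C.mcball x 0 = {x}"
      using x by (auto simp: C.mcball_def dest: antisym[OF _ C.nonneg])
    then show ?case
      using x by simp
  next
    case (Suc n)
    obtain K where K: "compactin mtopology K"
      and sub: "\<And>z. z \<in> C.mcball x (real n * e) \<Longrightarrow> mcball z (3 * e) \<subseteq> K"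
      using compactin_thickening_subset[OF Suc e, of "3 * e"] comp by auto
    have "C.mcball x (real (Suc n) * e) \<subseteq> K"
    proof
      fix y assume "y \<in> C.mcball x (real (Suc n) * e)"
      then have y: "y \<in> M" "chain_dist e x y \<le> real n * e + e"
        by (auto simp: algebra_simps)
      \<comment> \<open>The infimum need not be attained; the chain may be longer by less than another \<open>e\<close>.\<close>
      then obtain l where l: "chain e x y l" "l < real n * e + 2 * e"
        using chain_dist_approx[OF conn e x, of y "real n * e + 2 * e"] e by auto
      obtain z k where z: "chain e x z k" "k \<le> real n * e" "d z y \<le> max 0 (l - real n * e) + e"
        using chain_split[OF l(1), of "real n * e"] e by auto
      have "z \<in> C.mcball x (real n * e)"
        using chain_in_space[OF z(1)] chain_dist_le[OF z(1)] z(2) by auto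
      moreover have "y \<in> mcball z (3 * e)"
        using chain_in_space[OF z(1)] y z(3) l(2) e by auto
      ultimately show "y \<in> K"
        using sub by blast
    qed
    then show ?case
      using closed_compactin[OF K] closed by blast
  qed
  show ?thesis
    unfolding proper_metric_def top
  proof (intro ballI allI)
    fix x r assume x: "x \<in> M"
    obtain n where "r < real n * e"
      using reals_Archimedean3[OF e] by blast
    then have "C.mcball x r \<subseteq> C.mcball x (real n * e)"
      by auto
    then show "compactin mtopology (C.mcball x r)"
      using closed_compactin[OF multiples[OF x]] closed by blast
  qed
qed

text \<open>
  Only one inequality is available for an isometric map that need not be onto: its image may be
  joined by shorter chains that leave the image.
\<close>

lemma chain_dist_isometry_le:
  assumes conn: "connected_space mtopology" and e: "e > 0"
    and f: "\<And>u. u \<in> M \<Longrightarrow> f u \<in> M" "\<And>u v. u \<in> M \<Longrightarrow> v \<in> M \<Longrightarrow> d (f u) (f v) = d u v"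
    and xy: "x \<in> M" "y \<in> M"
  shows "chain_dist e (f x) (f y) \<le> chain_dist e x y"
proof -
  have "chain e (f x) (f z) l" if "chain e x z l" for z l
    using that
  proof (induction rule: chain.induct)
    case refl
    then show ?case
      using f by (auto intro: chain.refl)
  next
    case (step z l w)
    then show ?case
      using f chain.step[of e "f x" "f z" l "f w"] chain_in_space[OF step(1)] by simp
  qed
  then have "chain_dist e (f x) (f y) \<le> l" if "chain e x y l" for l
    using chain_dist_le that by blast
  then show ?thesis
    using chain_exists[OF conn e xy] xy
    by (subst (2) chain_dist_def) (auto intro!: cInf_greatest)
qed

end

section \<open>Coset spaces\<close>

lemma (in topological_group) continuous_map_left_translation:
  assumes "g \<in> carrier G"
  shows "continuous_map T T (\<lambda>x. g \<otimes> x)"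
proof -
  have "continuous_map T (prod_topology T T) (\<lambda>x. (g, x))"
    using assms topspace_eq by (simp add: continuous_map_pairwise o_def)
  from continuous_map_compose[OF this continuous_mult] show ?thesis
    by (simp add: o_def)
qed

lemma (in topological_group) continuous_map_right_translation:
  assumes "g \<in> carrier G"
  shows "continuous_map T T (\<lambda>x. x \<otimes> g)"
proof -
  have "continuous_map T (prod_topology T T) (\<lambda>x. (x, g))"
    using assms topspace_eq by (simp add: continuous_map_pairwise o_def)
  from continuous_map_compose[OF this continuous_mult] show ?thesis
    by (simp add: o_def)
qed

lemma (in group) l_coset_eq_iff:
  assumes "subgroup H G" "a \<in> carrier G" "b \<in> carrier G"
  shows "a <#\<^bsub>G\<^esub> H = b <#\<^bsub>G\<^esub> H \<longleftrightarrow> (\<exists>h\<in>H. a \<otimes> h = b)"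
proof
  assume "a <#\<^bsub>G\<^esub> H = b <#\<^bsub>G\<^esub> H"
  moreover have "b \<otimes> \<one> \<in> b <#\<^bsub>G\<^esub> H"
    using subgroup.one_closed[OF assms(1)] unfolding l_coset_def by blast
  ultimately have "b \<in> a <#\<^bsub>G\<^esub> H"
    using assms(3) by simp
  then show "\<exists>h\<in>H. a \<otimes> h = b"
    unfolding l_coset_def by auto
next
  assume "\<exists>h\<in>H. a \<otimes> h = b"
  then have "b \<in> a <#\<^bsub>G\<^esub> H"
    unfolding l_coset_def by auto
  then show "a <#\<^bsub>G\<^esub> H = b <#\<^bsub>G\<^esub> H"
    using l_repr_independence assms by blast
qed

text \<open>The saturation of an open set \<open>U\<close> is the union of its right translates by elements of \<open>H\<close>.\<close>

lemma (in topological_group) openin_image_coset_topology: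
  assumes H: "subgroup H G" and U: "openin T U"
  shows "openin (coset_topology G T H) ((\<lambda>g. g <#\<^bsub>G\<^esub> H) ` U)"
proof -
  have UG: "U \<subseteq> carrier G"
    using openin_subset[OF U] topspace_eq by simp
  have "g <#\<^bsub>G\<^esub> H \<in> (\<lambda>g. g <#\<^bsub>G\<^esub> H) ` U \<longleftrightarrow> (\<exists>h\<in>H. g \<otimes> h \<in> U)" if "g \<in> carrier G" for g
  proof -
    have "g <#\<^bsub>G\<^esub> H \<in> (\<lambda>g. g <#\<^bsub>G\<^esub> H) ` U \<longleftrightarrow> (\<exists>u\<in>U. g <#\<^bsub>G\<^esub> H = u <#\<^bsub>G\<^esub> H)"
      by (rule image_iff)
    also have "\<dots> \<longleftrightarrow> (\<exists>u\<in>U. \<exists>h\<in>H. g \<otimes> h = u)"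
      using l_coset_eq_iff[OF H that] UG by (intro bex_cong refl) blast
    finally show ?thesis
      by blast
  qed
  then have "{g \<in> topspace T. g <#\<^bsub>G\<^esub> H \<in> (\<lambda>g. g <#\<^bsub>G\<^esub> H) ` U}
      = (\<Union>h\<in>H. {g \<in> topspace T. g \<otimes> h \<in> U})"
    unfolding topspace_eq by blast
  moreover have "openin T {g \<in> topspace T. g \<otimes> h \<in> U}" if "h \<in> H" for h
    using openin_continuous_map_preimage[OF continuous_map_right_translation U]
      subgroup.mem_carrier[OF H that] by blast
  ultimately show ?thesis
    using UG by (auto simp: openin_coset_topology LCOSETS_def)
qed

text \<open>
  A compact neighbourhood \<open>K\<close> of the identity projects onto a neighbourhood of the base coset, hence
  onto a superset of some ball around it.  The translates of \<open>K\<close> are compact, and by invariance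
  their projections contain the balls of the same radius around all other cosets.
\<close>

lemma (in topological_group) uniformly_compact_balls:
  assumes lc: "locally_compact_space T" and H: "subgroup H G"
    and d: "compatible_metric (coset_topology G T H) d" and inv_d: "invariant_metric G H d"
  shows "\<exists>r>0. \<forall>x \<in> lcosets H.
           compactin (coset_topology G T H) (Metric_space.mcball (lcosets H) d x r)"
proof -
  let ?X = "coset_topology G T H" and ?q = "\<lambda>g. g <#\<^bsub>G\<^esub> H"
  have topX: "topspace ?X = lcosets H"
    by (rule topspace_coset_topology[OF topspace_eq])
  interpret Metric_space "lcosets H" d
    using d topX unfolding compatible_metric_def by simp
  have mtop: "mtopology = ?X"
    using d topX unfolding compatible_metric_def by simp
  have HG: "H \<subseteq> carrier G"
    by (rule subgroup.subset[OF H])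
  have q_cont: "continuous_map T ?X ?q"
    by (rule quotient_imp_continuous_map[OF quotient_map_coset_topology[OF topspace_eq]])
  obtain U K where UK: "openin T U" "compactin T K" "\<one> \<in> U" "U \<subseteq> K"
    using lc topspace_eq one_closed unfolding locally_compact_space_def by metis
  have KG: "K \<subseteq> carrier G"
    using compactin_subset_topspace[OF UK(2)] topspace_eq by simp
  have "openin mtopology (?q ` U)"
    using openin_image_coset_topology[OF H UK(1)] mtop by simp
  then obtain r where r: "r > 0" "mcball (\<one> <#\<^bsub>G\<^esub> H) r \<subseteq> ?q ` U"
    unfolding openin_mtopology_mcball using UK(3) by blast
  have coset_in: "b <#\<^bsub>G\<^esub> H \<in> lcosets H" if "b \<in> carrier G" for b
    using that by (auto simp: LCOSETS_def)
  have "compactin ?X (mcball x r)" if "x \<in> lcosets H" for x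
  proof -
    obtain g where g: "g \<in> carrier G" "x = g <#\<^bsub>G\<^esub> H"
      using \<open>x \<in> lcosets H\<close> by (auto simp: LCOSETS_def)
    let ?C = "?q ` (\<lambda>k. g \<otimes> k) ` K"
    have "compactin ?X ?C"
      using image_compactin[OF image_compactin[OF UK(2) continuous_map_left_translation[OF g(1)]] q_cont] .
    moreover have "mcball x r \<subseteq> ?C"
    proof
      fix y assume y: "y \<in> mcball x r"
      then have "y \<in> lcosets H"
        by simp
      then obtain a where a: "a \<in> carrier G" "y = a <#\<^bsub>G\<^esub> H"
        unfolding LCOSETS_def by blast
      have "d (inv g <#\<^bsub>G\<^esub> x) (inv g <#\<^bsub>G\<^esub> y) = d x y"
        using inv_d \<open>x \<in> lcosets H\<close> \<open>y \<in> lcosets H\<close> g(1)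
        unfolding invariant_metric_def by blast
      moreover have "inv g <#\<^bsub>G\<^esub> x = \<one> <#\<^bsub>G\<^esub> H" "inv g <#\<^bsub>G\<^esub> y = (inv g \<otimes> a) <#\<^bsub>G\<^esub> H"
        unfolding g(2) a(2) using g(1) a(1) HG by (simp_all add: lcos_m_assoc)
      moreover have "(inv g \<otimes> a) <#\<^bsub>G\<^esub> H \<in> lcosets H" "\<one> <#\<^bsub>G\<^esub> H \<in> lcosets H"
        using coset_in g(1) a(1) by simp_all
      ultimately have "(inv g \<otimes> a) <#\<^bsub>G\<^esub> H \<in> mcball (\<one> <#\<^bsub>G\<^esub> H) r"
        using y by simp
      then obtain k where k: "k \<in> K" "(inv g \<otimes> a) <#\<^bsub>G\<^esub> H = k <#\<^bsub>G\<^esub> H"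
        using r(2) UK(4) by blast
      have "y = g <#\<^bsub>G\<^esub> ((inv g \<otimes> a) <#\<^bsub>G\<^esub> H)"
        unfolding a(2) using g(1) a(1) HG by (simp add: lcos_m_assoc m_assoc[symmetric])
      also have "\<dots> = (g \<otimes> k) <#\<^bsub>G\<^esub> H"
        unfolding k(2) using k(1) g(1) KG HG by (simp add: lcos_m_assoc subsetD)
      finally show "y \<in> ?C"
        using k(1) by blast
    qed
    ultimately show ?thesis
      using closed_compactin closedin_mcball[of x r] mtop by metis
  qed
  then show ?thesis
    using r(1) by meson
qed

lemma (in group) l_coset_translate_in_lcosets:
  assumes "H \<subseteq> carrier G" "g \<in> carrier G" "x \<in> lcosets H"
  shows "g <#\<^bsub>G\<^esub> x \<in> lcosets H"
  using assms by (auto simp: LCOSETS_def lcos_m_assoc)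

lemma (in group) l_coset_inv_translate:
  assumes "H \<subseteq> carrier G" "g \<in> carrier G" "x \<in> lcosets H"
  shows "inv g <#\<^bsub>G\<^esub> (g <#\<^bsub>G\<^esub> x) = x"
  using assms by (auto simp: LCOSETS_def lcos_m_assoc m_assoc[symmetric])

lemma (in group) invariant_metric_chain_dist:
  assumes "Metric_space (lcosets H) d"
    and conn: "connected_space (Metric_space.mtopology (lcosets H) d)" and e: "e > 0"
    and H: "H \<subseteq> carrier G" and inv_d: "invariant_metric G H d"
  shows "invariant_metric G H (Metric_space.chain_dist (lcosets H) d e)"
proof -
  interpret Metric_space "lcosets H" d by fact
  have le: "chain_dist e (g <#\<^bsub>G\<^esub> x) (g <#\<^bsub>G\<^esub> y) \<le> chain_dist e x y"
    if "g \<in> carrier G" "x \<in> lcosets H" "y \<in> lcosets H" for g x y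
    using chain_dist_isometry_le[OF conn e, of "\<lambda>x. g <#\<^bsub>G\<^esub> x" x y] that inv_d
      l_coset_translate_in_lcosets[OF H]
    unfolding invariant_metric_def by blast
  show ?thesis
    unfolding invariant_metric_def
  proof (intro ballI antisym)
    fix g x y assume gxy: "g \<in> carrier G" "x \<in> lcosets H" "y \<in> lcosets H"
    show "chain_dist e (g <#\<^bsub>G\<^esub> x) (g <#\<^bsub>G\<^esub> y) \<le> chain_dist e x y"
      using le gxy by blast
    have "chain_dist e (inv g <#\<^bsub>G\<^esub> (g <#\<^bsub>G\<^esub> x)) (inv g <#\<^bsub>G\<^esub> (g <#\<^bsub>G\<^esub> y)) \<le> chain_dist e (g <#\<^bsub>G\<^esub> x) (g <#\<^bsub>G\<^esub> y)"
      using le gxy l_coset_translate_in_lcosets[OF H] by simp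
    then show "chain_dist e x y \<le> chain_dist e (g <#\<^bsub>G\<^esub> x) (g <#\<^bsub>G\<^esub> y)"
      using l_coset_inv_translate[OF H] gxy by simp
  qed
qed

theorem proposition2p9:
  fixes G :: "('a, 'b) monoid_scheme" and T :: "'a topology" and H :: "'a set"
  assumes "topological_group G T"
    and "second_countable T"
    and "locally_compact_space T"
    and "subgroup H G"
    and "closedin T H"
    and "connected_space (coset_topology G T H)"
  shows "(\<exists>d. compatible_metric (coset_topology G T H) d \<and> invariant_metric G H d) \<longleftrightarrow>
         (\<exists>d. compatible_metric (coset_topology G T H) d \<and> invariant_metric G H d \<and>
              proper_metric (lcosets\<^bsub>G\<^esub> H) d)"
proof
  interpret topological_group G T by fact
  let ?X = "coset_topology G T H" and ?M = "lcosets\<^bsub>G\<^esub> H"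
  assume "\<exists>d. compatible_metric ?X d \<and> invariant_metric G H d"
  then obtain d where d: "compatible_metric ?X d" and inv_d: "invariant_metric G H d"
    by blast
  have topX: "topspace ?X = ?M"
    by (rule topspace_coset_topology[OF topspace_eq])
  interpret Metric_space ?M d
    using d topX unfolding compatible_metric_def by simp
  have mtop: "mtopology = ?X"
    using d topX unfolding compatible_metric_def by simp
  have conn: "connected_space mtopology"
    using assms(6) mtop by simp
  obtain r where r: "r > 0" "\<And>x. x \<in> ?M \<Longrightarrow> compactin ?X (mcball x r)"
    using uniformly_compact_balls[OF assms(3,4) d inv_d] by blast
  define e where "e = r / 4"
  have e: "e > 0" "4 * e = r"
    using r(1) by (auto simp: e_def)
  have "compatible_metric ?X (chain_dist e)"
    unfolding compatible_metric_def topX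
    using Metric_space_chain_dist[OF conn e(1)] mtopology_chain_dist[OF conn e(1)] mtop by simp
  moreover have "invariant_metric G H (chain_dist e)"
    using invariant_metric_chain_dist[OF Metric_space_axioms conn e(1) subgroup.subset inv_d]
      assms(4) by blast
  moreover have "proper_metric ?M (chain_dist e)"
    using proper_chain_dist[OF conn e(1)] r(2) mtop e(2) by simp
  ultimately show "\<exists>d. compatible_metric ?X d \<and> invariant_metric G H d \<and> proper_metric ?M d"
    by blast
qed blast

end
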